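(* Let $N\in\mathbb{N}$, $N\ge 2$, $\mathcal{I}\in\mathbb{N}$, $k\in\mathbb{N}_0$, and let the parameters $T>0$, $\alpha_i,\beta_i,\gamma_i\in(0,1]$, $C_i\ge 0$, $\underline{u}_i<0<\bar{u}_i$ ($i=1,\dots,\mathcal{I}$) be fixed and constant over time. Put $\mathbb{X}=[0,C_1]\times\cdots\times[0,C_{\mathcal{I}}]$. Then the assignment $\varphi(\bar w,x(k),\bar\zeta)=\bar z$, where $\bar z$ is the optimal average power demand of the microgrid problem (P) described in the context, is a well-defined mapping. That is, for every $(\bar w,x(k),\bar\zeta)\in\mathbb{R}^N\times\mathbb{X}\times\mathbb{R}^N$ there exists a uniquely determined $\bar z\in\mathbb{R}^N$ (depending only on the triple $(\bar w,x(k),\bar\zeta)$ and the fixed parameters) such that, for every choice of individual net consumptions $w_1,\dots,w_{\mathcal{I}}\in\mathbb{R}^N$ with $\frac1{\mathcal{I}}\sum_{i=1}^{\mathcal{I}}w_i=\bar w$, $\bar z$ is the solution of problem (P) with data $(w_i)_{i=1}^{\mathcal{I}}$, $x(k)$, $\bar\zeta$.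
   Context: A microgrid consists of $\mathcal{I}$ subsystems with batteries. Let $k$ be the current time and $N$ the prediction horizon. Subsystem $i$ has net consumption $w_i=(w_i(k),\dots,w_i(k+N-1))^\top\in\mathbb{R}^N$, state of charge $x_i(n)$, charging rate $u_i^+(n)$ and discharging rate $u_i^-(n)$, and power demand $z_i(n)$. The dynamics are, for $n=k,\dots,k+N-1$, $$x_i(n+1)=\alpha_i x_i(n)+T\big(\beta_i u_i^+(n)+u_i^-(n)\big),\qquad z_i(n)=w_i(n)+u_i^+(n)+\gamma_i u_i^-(n),$$ where the initial state $x_i(k)$ is given by the $i$-th component of $x(k)\in\mathbb{X}$. The constraints are $$0\le x_i(n)\le C_i\quad (n=k,\dots,k+N),$$ $$\underline{u}_i\le u_i^-(n)\le 0,\qquad 0\le u_i^+(n)\le \bar u_i,\qquad 0\le \frac{u_i^-(n)}{\underline{u}_i}+\frac{u_i^+(n)}{\bar u_i}\le 1\quad (n=k,\dots,k+N-1).$$ Let $\mathbb{D}_i\subset\mathbb{R}^N$ be the set of all output vectors $z_i=(z_i(k),\dots,z_i(k+N-1))^\top$ for which there exist controls $(u_i^+(n),u_i^-(n))_{n=k}^{k+N-1}$ such that the dynamics (with the given initial state) and all constraints hold. Problem (P): given $w_1,\dots,w_{\mathcal{I}}\in\mathbb{R}^N$, $x(k)\in\mathbb{X}$ and a reference vector $\bar\zeta\in\mathbb{R}^N$, $$\min_{(z_1,\dots,z_{\mathcal{I}})\in\mathbb{D}_1\times\cdots\times\mathbb{D}_{\mathcal{I}}}\ \big\|\bar\zeta-\bar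 z\big\|_2^2,\qquad \bar z=\frac1{\mathcal{I}}\sum_{i=1}^{\mathcal{I}}z_i .$$ A vector $\bar z\in\mathbb{R}^N$ is called the solution of (P) if the minimizers $(z_1,\dots,z_{\mathcal{I}})$ of (P) exist and every one of them has average $\frac1{\mathcal{I}}\sum_{i=1}^{\mathcal{I}}z_i=\bar z$. *)

theory Defs
  imports "HOL-Analysis.Analysis"
begin

text \<open>
  Vectors over the prediction horizon are functions on the time instants \<open>{k..<k+N}\<close>, made
  extensional so that equality of functions is equality of vectors.
\<close>

definition horizon_vecs :: "nat \<Rightarrow> nat \<Rightarrow> (nat \<Rightarrow> real) set" where
  "horizon_vecs k N = {k..<k+N} \<rightarrow>\<^sub>E UNIV"

record subsystem =
  alpha :: real
  beta :: real
  gamma :: real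
  cap :: real
  u_min :: real
  u_max :: real

text \<open>
  In the following definition \<open>up\<close> and \<open>um\<close> are the charging and discharging rates
  \<open>u\<^sup>+\<close> and \<open>u\<^sup>-\<close>. Note that \<open>u_min\<close> is negative, so both quotients in the last
  constraint are nonnegative. The state is also constrained at the terminal time \<open>k+N\<close>.
\<close>

definition demand_set ::
    "nat \<Rightarrow> nat \<Rightarrow> real \<Rightarrow> subsystem \<Rightarrow> (nat \<Rightarrow> real) \<Rightarrow> real \<Rightarrow> (nat \<Rightarrow> real) set" where
  "demand_set k N T s w x0 =
    {z \<in> horizon_vecs k N. \<exists>x up um :: nat \<Rightarrow> real.
       x k = x0 \<and>
       (\<forall>n\<in>{k..<k+N}.
          x (n + 1) = alpha s * x n + T * (beta s * up n + um n) \<and>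
          z n = w n + up n + gamma s * um n) \<and>
       (\<forall>n\<in>{k..k+N}. 0 \<le> x n \<and> x n \<le> cap s) \<and>
       (\<forall>n\<in>{k..<k+N}.
          u_min s \<le> um n \<and> um n \<le> 0 \<and>
          0 \<le> up n \<and> up n \<le> u_max s \<and>
          0 \<le> um n / u_min s + up n / u_max s \<and>
          um n / u_min s + up n / u_max s \<le> 1)}"

definition average :: "nat \<Rightarrow> nat \<Rightarrow> nat \<Rightarrow> (nat \<Rightarrow> nat \<Rightarrow> real) \<Rightarrow> nat \<Rightarrow> real" where
  "average k N I z = (\<lambda>n\<in>{k..<k+N}. 1 / real I * (\<Sum>i=1..I. z i n))"

definition is_minimizer ::
    "nat \<Rightarrow> nat \<Rightarrow> real \<Rightarrow> nat \<Rightarrow> (nat \<Rightarrow> subsystem) \<Rightarrow> (nat \<Rightarrow> nat \<Rightarrow> real) \<Rightarrow> (nat \<Rightarrow> real) \<Rightarrow>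
     (nat \<Rightarrow> real) \<Rightarrow> (nat \<Rightarrow> nat \<Rightarrow> real) \<Rightarrow> bool" where
  "is_minimizer k N T I S w x0 \<zeta> z \<longleftrightarrow>
     is_arg_min (\<lambda>z. (L2_set (\<lambda>n. \<zeta> n - average k N I z n) {k..<k+N})\<^sup>2)
       (\<lambda>z. z \<in> (\<Pi>\<^sub>E i\<in>{1..I}. demand_set k N T (S i) (w i) (x0 i))) z"

definition is_solution ::
    "nat \<Rightarrow> nat \<Rightarrow> real \<Rightarrow> nat \<Rightarrow> (nat \<Rightarrow> subsystem) \<Rightarrow> (nat \<Rightarrow> nat \<Rightarrow> real) \<Rightarrow> (nat \<Rightarrow> real) \<Rightarrow>
     (nat \<Rightarrow> real) \<Rightarrow> (nat \<Rightarrow> real) \<Rightarrow> bool" where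
  "is_solution k N T I S w x0 \<zeta> zbar \<longleftrightarrow>
     zbar \<in> horizon_vecs k N \<and>
     (\<exists>z. is_minimizer k N T I S w x0 \<zeta> z) \<and>
     (\<forall>z. is_minimizer k N T I S w x0 \<zeta> z \<longrightarrow> average k N I z = zbar)"

definition state_space :: "nat \<Rightarrow> (nat \<Rightarrow> subsystem) \<Rightarrow> (nat \<Rightarrow> real) set" where
  "state_space I S = (\<Pi>\<^sub>E i\<in>{1..I}. {0..cap (S i)})"

end

theory Submission
  imports Defs
begin

text \<open>
  The objective of the problem depends on the demand vectors \<open>z\<^sub>i\<close> only through their average, and it
  measures the squared Euclidean distance of that average from \<open>\<zeta>\<close>. So the minimizers are exactly the
  admissible families whose average is a nearest point of the set of attainable averages
  to \<open>\<zeta>\<close>. The claim therefore amounts to two facts about this set.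

  First, it has exactly one nearest point to \<open>\<zeta>\<close>, because it is nonempty, compact and
  closed under midpoints (\<open>ex1_nearest_point\<close>). These properties are inherited from the individual
  demand sets. They are nonempty, since leaving the battery alone is always feasible
  (\<open>demand_set_nonempty\<close>); compact, since they are continuous images of a
  compact set of controls (\<open>compact_demand_set\<close>); and closed under midpoints, since all constraints
  are linear (\<open>demand_set_midpoint\<close>).

  Secondly, it depends on the net consumptions only through their average. Indeed \<open>w\<^sub>i\<close> enters the
  demand as an additive constant and does not affect the feasibility of controls, so a change of
  \<open>w\<^sub>i\<close> translates the demand set of subsystem \<open>i\<close>; on averages only the averaged translation is
  visible, and it vanishes when the average consumption is unchanged
  (\<open>attainable_averages_cong\<close>).
\<close>

section \<open>Compactness of the demand sets\<close>

text \<open>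
  The state of charge is a function of the controls, here written with \<open>m\<close> counting the
  steps since the current time \<open>k\<close>. The charging and discharging rates at time \<open>n\<close> form the pair \<open>c n\<close>.
\<close>

primrec charge_state ::
    "nat \<Rightarrow> real \<Rightarrow> subsystem \<Rightarrow> real \<Rightarrow> (nat \<Rightarrow> real \<times> real) \<Rightarrow> nat \<Rightarrow> real" where
  "charge_state k T s x0 c 0 = x0"
| "charge_state k T s x0 c (Suc m) =
     alpha s * charge_state k T s x0 c m + T * (beta s * fst (c (k + m)) + snd (c (k + m)))"

definition control_polytope :: "subsystem \<Rightarrow> (real \<times> real) set" where
  "control_polytope s = ({0..u_max s} \<times> {u_min s..0}) \<inter>
     {v. 0 \<le> snd v / u_min s + fst v / u_max s} \<inter> {v. snd v / u_min s + fst v / u_max s \<le> 1}"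

text \<open>
  Controls outside the horizon have no effect; fixing them to zero makes the set of
  control sequences a product of compact sets.
\<close>

definition control_box :: "nat \<Rightarrow> nat \<Rightarrow> subsystem \<Rightarrow> (nat \<Rightarrow> real \<times> real) set" where
  "control_box k N s =
     (\<Pi>\<^sub>E n\<in>UNIV. if n \<in> {k..<k+N} then control_polytope s else {(0, 0)})"

definition feasible_controls ::
    "nat \<Rightarrow> nat \<Rightarrow> real \<Rightarrow> subsystem \<Rightarrow> real \<Rightarrow> (nat \<Rightarrow> real \<times> real) set" where
  "feasible_controls k N T s x0 =
     control_box k N s \<inter> (\<Inter>m\<in>{..N}. {c. 0 \<le> charge_state k T s x0 c m \<and> charge_state k T s x0 c m \<le> cap s})"

definition demand_of ::
    "nat \<Rightarrow> nat \<Rightarrow> subsystem \<Rightarrow> (nat \<Rightarrow> real) \<Rightarrow> (nat \<Rightarrow> real \<times> real) \<Rightarrow> nat \<Rightarrow> real" where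
  "demand_of k N s w c = (\<lambda>n\<in>{k..<k+N}. w n + fst (c n) + gamma s * snd (c n))"

lemma demand_set_eq_image:
  "demand_set k N T s w x0 = demand_of k N s w ` feasible_controls k N T s x0"
proof (intro equalityI subsetI)
  fix z assume "z \<in> demand_set k N T s w x0"
  then obtain x up um where z: "z \<in> horizon_vecs k N" and x0: "x k = x0"
    and dyn: "\<And>n. n \<in> {k..<k+N} \<Longrightarrow>
          x (n + 1) = alpha s * x n + T * (beta s * up n + um n) \<and>
          z n = w n + up n + gamma s * um n"
    and cap: "\<And>n. n \<in> {k..k+N} \<Longrightarrow> 0 \<le> x n \<and> x n \<le> cap s"
    and con: "\<And>n. n \<in> {k..<k+N} \<Longrightarrow> u_min s \<le> um n \<and> um n \<le> 0 \<and>
          0 \<le> up n \<and> up n \<le> u_max s \<and>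
          0 \<le> um n / u_min s + up n / u_max s \<and>
          um n / u_min s + up n / u_max s \<le> 1"
    unfolding demand_set_def mem_Collect_eq by blast
  define c where "c n = (if n \<in> {k..<k+N} then (up n, um n) else (0, 0))" for n
  have state: "charge_state k T s x0 c m = x (k + m)" if "m \<le> N" for m
    using that
  proof (induction m)
    case (Suc m)
    then show ?case using dyn[of "k + m"] by (simp add: c_def)
  qed (simp add: x0)
  have "c \<in> feasible_controls k N T s x0"
    using con cap by (auto simp: feasible_controls_def control_box_def state)
      (auto simp: c_def control_polytope_def)
  moreover have "z = demand_of k N s w c"
    using z dyn by (auto simp: fun_eq_iff demand_of_def horizon_vecs_def c_def PiE_iff extensional_def)
  ultimately show "z \<in> demand_of k N s w ` feasible_controls k N T s x0" by blast
next
  fix z assume "z \<in> demand_of k N s w ` feasible_controls k N T s x0"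
  then obtain c where c: "c \<in> feasible_controls k N T s x0" and z: "z = demand_of k N s w c"
    by blast
  have poly: "c n \<in> control_polytope s" if "n \<in> {k..<k+N}" for n
    using c that by (auto simp: feasible_controls_def control_box_def PiE_iff split: if_splits)
  define x where "x n = charge_state k T s x0 c (n - k)" for n
  have "z \<in> horizon_vecs k N"
    by (simp add: z demand_of_def horizon_vecs_def)
  moreover have "x k = x0"
    by (simp add: x_def)
  moreover have "\<forall>n\<in>{k..<k+N}.
      x (n + 1) = alpha s * x n + T * (beta s * fst (c n) + snd (c n)) \<and>
      z n = w n + fst (c n) + gamma s * snd (c n)"
    by (auto simp: x_def Suc_diff_le z demand_of_def)
  moreover have "\<forall>n\<in>{k..k+N}. 0 \<le> x n \<and> x n \<le> cap s"
  proof
    fix n assume "n \<in> {k..k+N}"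
    then have "n - k \<in> {..N}" by auto
    with c show "0 \<le> x n \<and> x n \<le> cap s"
      unfolding feasible_controls_def x_def by blast
  qed
  moreover have "\<forall>n\<in>{k..<k+N}.
          u_min s \<le> snd (c n) \<and> snd (c n) \<le> 0 \<and>
          0 \<le> fst (c n) \<and> fst (c n) \<le> u_max s \<and>
          0 \<le> snd (c n) / u_min s + fst (c n) / u_max s \<and>
          snd (c n) / u_min s + fst (c n) / u_max s \<le> 1"
    using poly by (force simp: control_polytope_def)
  ultimately show "z \<in> demand_set k N T s w x0"
    unfolding demand_set_def mem_Collect_eq
    by (intro conjI exI[of _ x] exI[of _ "\<lambda>n. fst (c n)"] exI[of _ "\<lambda>n. snd (c n)"]) auto
qed

lemma compact_PiE_UNIV:
  fixes K :: "'a \<Rightarrow> 'b::topological_space set"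
  assumes "\<And>n. compact (K n)"
  shows "compact (\<Pi>\<^sub>E n\<in>UNIV. K n)"
proof -
  have "compactin (product_topology (\<lambda>_. euclidean) UNIV) (\<Pi>\<^sub>E n\<in>UNIV. K n)"
    using assms by (simp add: compactin_PiE)
  then show ?thesis
    by (simp add: euclidean_product_topology)
qed

lemma continuous_on_charge_state: "continuous_on UNIV (\<lambda>c. charge_state k T s x0 c m)"
proof (induction m)
  case (Suc m)
  then show ?case
    unfolding charge_state.simps by (intro continuous_intros continuous_on_product_coordinates)
qed simp

lemma compact_control_polytope:
  assumes "u_min s < 0" "0 < u_max s"
  shows "compact (control_polytope s)"
  unfolding control_polytope_def
  using assms by (intro compact_Int_closed compact_Times compact_Icc closed_Collect_le continuous_intros) auto

lemma compact_demand_set: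
  assumes "u_min s < 0" "0 < u_max s"
  shows "compact (demand_set k N T s w x0)"
proof -
  have "compact (control_box k N s)"
    unfolding control_box_def using assms by (intro compact_PiE_UNIV) (auto intro: compact_control_polytope)
  then have "compact (feasible_controls k N T s x0)"
    unfolding feasible_controls_def
    by (intro compact_Int_closed closed_INT ballI closed_Collect_conj closed_Collect_le
        continuous_intros continuous_on_charge_state)
  moreover have "continuous_on A (demand_of k N s w)" for A
  proof (rule continuous_on_coordinatewise_then_product)
    fix n
    have "continuous_on A (\<lambda>c. w n + fst (c n) + gamma s * snd (c n))"
      by (intro continuous_intros continuous_on_subset[OF continuous_on_product_coordinates]) auto
    then show "continuous_on A (\<lambda>c. demand_of k N s w c n)"
      by (cases "n \<in> {k..<k+N}") (simp_all only: demand_of_def restrict_apply if_True if_False simp_thms continuous_on_const)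
  qed
  ultimately show ?thesis
    unfolding demand_set_eq_image by (intro compact_continuous_image)
qed

section \<open>Nonemptiness, midpoints and translations of the demand sets\<close>

text \<open>
  With zero controls each step multiplies the state by \<open>alpha s\<close>, which lies between 0 and 1, so the
  state stays between zero and its initial value.
\<close>

lemma demand_set_nonempty:
  assumes "0 < alpha s" "alpha s \<le> 1" "u_min s < 0" "0 < u_max s" "x0 \<in> {0..cap s}"
  shows "demand_set k N T s w x0 \<noteq> {}"
proof -
  have "0 \<le> charge_state k T s x0 (\<lambda>_. (0, 0)) m \<and> charge_state k T s x0 (\<lambda>_. (0, 0)) m \<le> cap s" for m
  proof (induction m)
    case (Suc m)
    moreover have "alpha s * charge_state k T s x0 (\<lambda>_. (0, 0)) m \<le> charge_state k T s x0 (\<lambda>_. (0, 0)) m"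
      using Suc assms by (intro mult_left_le_one_le) auto
    ultimately show ?case using assms by simp
  qed (use assms in simp)
  then have "(\<lambda>_. (0, 0)) \<in> feasible_controls k N T s x0"
    using assms by (auto simp: feasible_controls_def control_box_def control_polytope_def)
  then show ?thesis
    unfolding demand_set_eq_image by blast
qed

definition midpoint_on :: "nat set \<Rightarrow> (nat \<Rightarrow> real) \<Rightarrow> (nat \<Rightarrow> real) \<Rightarrow> nat \<Rightarrow> real" where
  "midpoint_on H a b = (\<lambda>n\<in>H. (a n + b n) / 2)"

lemma demand_set_midpoint:
  assumes "z \<in> demand_set k N T s w x0" "z' \<in> demand_set k N T s w x0"
  shows "midpoint_on {k..<k+N} z z' \<in> demand_set k N T s w x0"
proof -
  obtain x up um where x0: "x k = x0"
    and dyn: "\<And>n. n \<in> {k..<k+N} \<Longrightarrow>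
          x (n + 1) = alpha s * x n + T * (beta s * up n + um n) \<and>
          z n = w n + up n + gamma s * um n"
    and cap: "\<And>n. n \<in> {k..k+N} \<Longrightarrow> 0 \<le> x n \<and> x n \<le> cap s"
    and con: "\<And>n. n \<in> {k..<k+N} \<Longrightarrow> u_min s \<le> um n \<and> um n \<le> 0 \<and>
          0 \<le> up n \<and> up n \<le> u_max s \<and>
          0 \<le> um n / u_min s + up n / u_max s \<and>
          um n / u_min s + up n / u_max s \<le> 1"
    using assms(1) unfolding demand_set_def mem_Collect_eq by blast
  obtain x' up' um' where x0': "x' k = x0"
    and dyn': "\<And>n. n \<in> {k..<k+N} \<Longrightarrow>
          x' (n + 1) = alpha s * x' n + T * (beta s * up' n + um' n) \<and>
          z' n = w n + up' n + gamma s * um' n"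
    and cap': "\<And>n. n \<in> {k..k+N} \<Longrightarrow> 0 \<le> x' n \<and> x' n \<le> cap s"
    and con': "\<And>n. n \<in> {k..<k+N} \<Longrightarrow> u_min s \<le> um' n \<and> um' n \<le> 0 \<and>
          0 \<le> up' n \<and> up' n \<le> u_max s \<and>
          0 \<le> um' n / u_min s + up' n / u_max s \<and>
          um' n / u_min s + up' n / u_max s \<le> 1"
    using assms(2) unfolding demand_set_def mem_Collect_eq by blast
  define X where "X n = (x n + x' n) / 2" for n
  define Up where "Up n = (up n + up' n) / 2" for n
  define Um where "Um n = (um n + um' n) / 2" for n
  have unit_midpoint: "0 \<le> (a + b) / 2 \<and> (a + b) / 2 \<le> 1"
    if "0 \<le> a" "a \<le> 1" "0 \<le> b" "b \<le> 1" for a b :: real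
    using that by simp
  have "midpoint_on {k..<k+N} z z' \<in> horizon_vecs k N"
    by (simp add: midpoint_on_def horizon_vecs_def)
  moreover have "X k = x0"
    by (simp add: X_def x0 x0')
  moreover have "\<forall>n\<in>{k..<k+N}.
      X (n + 1) = alpha s * X n + T * (beta s * Up n + Um n) \<and>
      midpoint_on {k..<k+N} z z' n = w n + Up n + gamma s * Um n"
    using dyn dyn' by (simp add: X_def Up_def Um_def midpoint_on_def field_simps)
  moreover have "\<forall>n\<in>{k..k+N}. 0 \<le> X n \<and> X n \<le> cap s"
    using cap cap' by (fastforce simp: X_def)
  moreover have "\<forall>n\<in>{k..<k+N}. u_min s \<le> Um n \<and> Um n \<le> 0 \<and> 0 \<le> Up n \<and> Up n \<le> u_max s \<and>
          0 \<le> Um n / u_min s + Up n / u_max s \<and>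
          Um n / u_min s + Up n / u_max s \<le> 1"
  proof
    fix n assume n: "n \<in> {k..<k+N}"
    have "u_min s \<le> Um n" "Um n \<le> 0" "0 \<le> Up n" "Up n \<le> u_max s"
      using con[OF n] con'[OF n] by (auto simp: Um_def Up_def)
    moreover have "Um n / u_min s + Up n / u_max s =
        ((um n / u_min s + up n / u_max s) + (um' n / u_min s + up' n / u_max s)) / 2"
      by (simp add: Um_def Up_def add_divide_distrib)
    ultimately show "u_min s \<le> Um n \<and> Um n \<le> 0 \<and> 0 \<le> Up n \<and> Up n \<le> u_max s \<and>
          0 \<le> Um n / u_min s + Up n / u_max s \<and> Um n / u_min s + Up n / u_max s \<le> 1"
      using unit_midpoint con[OF n] con'[OF n] by presburger
  qed
  ultimately show ?thesis
    unfolding demand_set_def mem_Collect_eq by blast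
qed

lemma demand_set_translate:
  assumes "z \<in> demand_set k N T s w x0"
  shows "(\<lambda>n\<in>{k..<k+N}. z n - w n + w' n) \<in> demand_set k N T s w' x0"
proof -
  obtain c where "c \<in> feasible_controls k N T s x0" "z = demand_of k N s w c"
    using assms unfolding demand_set_eq_image by blast
  moreover from this have "(\<lambda>n\<in>{k..<k+N}. z n - w n + w' n) = demand_of k N s w' c"
    by (auto simp: demand_of_def fun_eq_iff)
  ultimately show ?thesis
    unfolding demand_set_eq_image by blast
qed

section \<open>Attainable averages\<close>

definition attainable_averages ::
    "nat \<Rightarrow> nat \<Rightarrow> real \<Rightarrow> nat \<Rightarrow> (nat \<Rightarrow> subsystem) \<Rightarrow> (nat \<Rightarrow> nat \<Rightarrow> real) \<Rightarrow> (nat \<Rightarrow> real) \<Rightarrow>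
     (nat \<Rightarrow> real) set" where
  "attainable_averages k N T I S w x0 =
     average k N I ` (\<Pi>\<^sub>E i\<in>{1..I}. demand_set k N T (S i) (w i) (x0 i))"

lemma attainable_averages_subset_horizon_vecs:
  "attainable_averages k N T I S w x0 \<subseteq> horizon_vecs k N"
  by (auto simp: attainable_averages_def average_def horizon_vecs_def)

lemma compact_attainable_averages:
  assumes "\<And>i. i \<in> {1..I} \<Longrightarrow> u_min (S i) < 0 \<and> 0 < u_max (S i)"
  shows "compact (attainable_averages k N T I S w x0)"
proof -
  let ?D = "\<lambda>i. demand_set k N T (S i) (w i) (x0 i)"
  \<comment> \<open>an extensional product becomes a product over all indices with singleton factors outside\<close>
  have "(\<Pi>\<^sub>E i\<in>{1..I}. ?D i) = (\<Pi>\<^sub>E i\<in>UNIV. if i \<in> {1..I} then ?D i else {undefined})"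
    by (auto simp: PiE_iff extensional_def split: if_splits)
  moreover have "compact \<dots>"
    using assms by (intro compact_PiE_UNIV) (auto intro: compact_demand_set)
  ultimately have "compact (\<Pi>\<^sub>E i\<in>{1..I}. ?D i)"
    by simp
  moreover have "continuous_on A (average k N I)" for A
  proof (rule continuous_on_coordinatewise_then_product)
    fix n
    have "continuous_on A (\<lambda>z. z i n)" for i :: nat
      by (rule continuous_on_product_then_coordinatewise[OF
            continuous_on_product_then_coordinatewise]) (rule continuous_on_id)
    then have "continuous_on A (\<lambda>z. 1 / real I * (\<Sum>i=1..I. z i n))"
      by (intro continuous_on_mult continuous_on_const continuous_on_sum)
    then show "continuous_on A (\<lambda>z. average k N I z n)"
      by (cases "n \<in> {k..<k+N}")
        (simp_all only: average_def restrict_apply if_True if_False simp_thms continuous_on_const)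
  qed
  ultimately show ?thesis
    unfolding attainable_averages_def by (intro compact_continuous_image)
qed

lemma attainable_averages_nonempty:
  assumes "\<And>i. i \<in> {1..I} \<Longrightarrow> demand_set k N T (S i) (w i) (x0 i) \<noteq> {}"
  shows "attainable_averages k N T I S w x0 \<noteq> {}"
  using assms by (simp add: attainable_averages_def PiE_eq_empty_iff)

lemma attainable_averages_midpoint:
  assumes "a \<in> attainable_averages k N T I S w x0" "b \<in> attainable_averages k N T I S w x0"
  shows "midpoint_on {k..<k+N} a b \<in> attainable_averages k N T I S w x0"
proof -
  obtain y z where y: "y \<in> (\<Pi>\<^sub>E i\<in>{1..I}. demand_set k N T (S i) (w i) (x0 i))"
      and a: "a = average k N I y"
      and z: "z \<in> (\<Pi>\<^sub>E i\<in>{1..I}. demand_set k N T (S i) (w i) (x0 i))"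
      and b: "b = average k N I z"
    using assms unfolding attainable_averages_def by blast
  define v where "v = (\<lambda>i\<in>{1..I}. midpoint_on {k..<k+N} (y i) (z i))"
  have "v \<in> (\<Pi>\<^sub>E i\<in>{1..I}. demand_set k N T (S i) (w i) (x0 i))"
    unfolding v_def using y z by (intro restrict_PiE_iff[THEN iffD2] ballI demand_set_midpoint) auto
  moreover have "midpoint_on {k..<k+N} a b = average k N I v"
  proof
    fix n
    have "(\<Sum>i=1..I. v i n) = (\<Sum>i=1..I. (y i n + z i n) / 2)" if "n \<in> {k..<k+N}"
      using that by (intro sum.cong) (auto simp: v_def midpoint_on_def)
    also have "\<dots> = ((\<Sum>i=1..I. y i n) + (\<Sum>i=1..I. z i n)) / 2"
      by (simp add: sum.distrib flip: sum_divide_distrib)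
    finally show "midpoint_on {k..<k+N} a b n = average k N I v n"
      by (simp add: a b midpoint_on_def average_def algebra_simps add_divide_distrib)
  qed
  ultimately show ?thesis
    unfolding attainable_averages_def by blast
qed

text \<open>
  Translating each \<open>z\<^sub>i\<close> from \<open>D(w\<^sub>i)\<close> by \<open>w'\<^sub>i - w\<^sub>i\<close> lands in \<open>D(w'\<^sub>i)\<close> and leaves the
  average unchanged, since the translations sum to zero.
\<close>

lemma attainable_averages_mono:
  assumes "average k N I w = average k N I w'"
  shows "attainable_averages k N T I S w x0 \<subseteq> attainable_averages k N T I S w' x0"
proof
  fix a assume "a \<in> attainable_averages k N T I S w x0"
  then obtain z where z: "z \<in> (\<Pi>\<^sub>E i\<in>{1..I}. demand_set k N T (S i) (w i) (x0 i))"
    and a: "a = average k N I z"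
    unfolding attainable_averages_def by blast
  define v where "v = (\<lambda>i\<in>{1..I}. \<lambda>n\<in>{k..<k+N}. z i n - w i n + w' i n)"
  have "v \<in> (\<Pi>\<^sub>E i\<in>{1..I}. demand_set k N T (S i) (w' i) (x0 i))"
    unfolding v_def using z by (intro restrict_PiE_iff[THEN iffD2] ballI demand_set_translate) auto
  moreover have "a = average k N I v"
  proof
    fix n
    show "a n = average k N I v n"
    proof (cases "n \<in> {k..<k+N}")
      case True
      have "(\<Sum>i=1..I. v i n) = (\<Sum>i=1..I. z i n - w i n + w' i n)"
        using True by (intro sum.cong) (auto simp: v_def)
      also have "\<dots> = (\<Sum>i=1..I. z i n) - (\<Sum>i=1..I. w i n) + (\<Sum>i=1..I. w' i n)"
        by (simp add: sum.distrib sum_subtractf)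
      finally have "average k N I v n = average k N I z n - average k N I w n + average k N I w' n"
        using True by (simp only: average_def restrict_apply' distrib_left right_diff_distrib)
      then show ?thesis by (simp add: a assms)
    qed (simp only: a average_def restrict_apply if_False)
  qed
  ultimately show "a \<in> attainable_averages k N T I S w' x0"
    unfolding attainable_averages_def by blast
qed

lemma attainable_averages_cong:
  assumes "average k N I w = average k N I w'"
  shows "attainable_averages k N T I S w x0 = attainable_averages k N T I S w' x0"
  using assms by (intro equalityI attainable_averages_mono) auto

section \<open>The nearest attainable average\<close>

text \<open>
  A nearest point exists by compactness. If there were two, the parallelogram law would make their
  midpoint strictly closer.
\<close>

lemma ex1_nearest_point:
  fixes A :: "(nat \<Rightarrow> real) set"
  assumes "compact A" "A \<noteq> {}" "A \<subseteq> H \<rightarrow>\<^sub>E UNIV" "finite H"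
    and mid: "\<And>a b. a \<in> A \<Longrightarrow> b \<in> A \<Longrightarrow> midpoint_on H a b \<in> A"
  shows "\<exists>!a. is_arg_min (\<lambda>a. (L2_set (\<lambda>n. \<zeta> n - a n) H)\<^sup>2) (\<lambda>a. a \<in> A) a"
proof -
  define f where "f = (\<lambda>a. (L2_set (\<lambda>n. \<zeta> n - a n) H)\<^sup>2)"
  have f: "f a = (\<Sum>n\<in>H. (\<zeta> n - a n)\<^sup>2)" for a
    by (simp add: f_def L2_set_def sum_nonneg)
  have "continuous_on A f"
    unfolding f by (intro continuous_intros continuous_on_subset[OF continuous_on_product_coordinates]) auto
  then obtain a where a: "a \<in> A" "\<And>b. b \<in> A \<Longrightarrow> f a \<le> f b"
    using continuous_attains_inf[OF assms(1,2)] by blast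
  have "b = a" if b: "is_arg_min f (\<lambda>a. a \<in> A) b" for b
  proof -
    have bA: "b \<in> A" and "f b = f a"
      using b a by (auto simp: is_arg_min_linorder intro: antisym)
    have "f (midpoint_on H a b) = (\<Sum>n\<in>H. (\<zeta> n - a n)\<^sup>2 / 2 + (\<zeta> n - b n)\<^sup>2 / 2 - (a n - b n)\<^sup>2 / 4)"
      unfolding f by (intro sum.cong) (auto simp: midpoint_on_def power2_eq_square field_simps)
    also have "\<dots> = f a / 2 + f b / 2 - (\<Sum>n\<in>H. (a n - b n)\<^sup>2) / 4"
      by (simp add: f sum.distrib sum_subtractf sum_divide_distrib)
    finally have "(\<Sum>n\<in>H. (a n - b n)\<^sup>2) \<le> 0"
      using a(2)[OF mid[OF a(1) bA]] \<open>f b = f a\<close> by simp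
    then have "(\<Sum>n\<in>H. (a n - b n)\<^sup>2) = 0"
      by (intro antisym sum_nonneg) auto
    then have "\<forall>n\<in>H. a n = b n"
      using \<open>finite H\<close> by (simp add: sum_nonneg_eq_0_iff)
    then show "b = a"
      using assms(3) a(1) bA by (intro PiE_ext[of _ H "\<lambda>_. UNIV"]) auto
  qed
  moreover have "is_arg_min f (\<lambda>a. a \<in> A) a"
    using a by (auto simp: is_arg_min_linorder)
  ultimately show ?thesis
    unfolding f_def by blast
qed

lemma is_minimizer_iff:
  "is_minimizer k N T I S w x0 \<zeta> z \<longleftrightarrow>
     z \<in> (\<Pi>\<^sub>E i\<in>{1..I}. demand_set k N T (S i) (w i) (x0 i)) \<and>
     is_arg_min (\<lambda>a. (L2_set (\<lambda>n. \<zeta> n - a n) {k..<k+N})\<^sup>2)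
       (\<lambda>a. a \<in> attainable_averages k N T I S w x0) (average k N I z)"
  unfolding is_minimizer_def is_arg_min_def attainable_averages_def by blast

lemma is_solution_iff:
  assumes "\<exists>!a. is_arg_min (\<lambda>a. (L2_set (\<lambda>n. \<zeta> n - a n) {k..<k+N})\<^sup>2)
      (\<lambda>a. a \<in> attainable_averages k N T I S w x0) a"
  shows "is_solution k N T I S w x0 \<zeta> zbar \<longleftrightarrow>
    is_arg_min (\<lambda>a. (L2_set (\<lambda>n. \<zeta> n - a n) {k..<k+N})\<^sup>2)
      (\<lambda>a. a \<in> attainable_averages k N T I S w x0) zbar"
    (is "_ \<longleftrightarrow> ?nearest zbar")
proof
  assume "is_solution k N T I S w x0 \<zeta> zbar"
  then show "?nearest zbar"
    unfolding is_solution_def is_minimizer_iff by blast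
next
  assume near: "?nearest zbar"
  then have mem: "zbar \<in> attainable_averages k N T I S w x0"
    by (simp add: is_arg_min_def)
  then obtain z where "z \<in> (\<Pi>\<^sub>E i\<in>{1..I}. demand_set k N T (S i) (w i) (x0 i))"
    and "zbar = average k N I z"
    unfolding attainable_averages_def by blast
  with near have "\<exists>z. is_minimizer k N T I S w x0 \<zeta> z"
    unfolding is_minimizer_iff by blast
  moreover have "average k N I z = zbar" if "is_minimizer k N T I S w x0 \<zeta> z" for z
    using that near assms unfolding is_minimizer_iff by blast
  moreover have "zbar \<in> horizon_vecs k N"
    using mem attainable_averages_subset_horizon_vecs by blast
  ultimately show "is_solution k N T I S w x0 \<zeta> zbar"
    unfolding is_solution_def by blast
qed

theorem proposition1:
  fixes N I k :: nat and T :: real and S :: "nat \<Rightarrow> subsystem"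
  assumes "N \<ge> 2" and "I \<ge> 1" and "T > 0"
    and "\<And>i. i \<in> {1..I} \<Longrightarrow> 0 < alpha (S i) \<and> alpha (S i) \<le> 1"
    and "\<And>i. i \<in> {1..I} \<Longrightarrow> 0 < beta (S i) \<and> beta (S i) \<le> 1"
    and "\<And>i. i \<in> {1..I} \<Longrightarrow> 0 < gamma (S i) \<and> gamma (S i) \<le> 1"
    and "\<And>i. i \<in> {1..I} \<Longrightarrow> cap (S i) \<ge> 0"
    and "\<And>i. i \<in> {1..I} \<Longrightarrow> u_min (S i) < 0 \<and> 0 < u_max (S i)"
  shows "\<forall>wbar \<in> horizon_vecs k N. \<forall>x0 \<in> state_space I S. \<forall>\<zeta> \<in> horizon_vecs k N.
    \<exists>!zbar. zbar \<in> horizon_vecs k N \<and>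
      (\<forall>w \<in> {1..I} \<rightarrow>\<^sub>E horizon_vecs k N.
         average k N I w = wbar \<longrightarrow> is_solution k N T I S w x0 \<zeta> zbar)"
proof (intro ballI)
  fix wbar x0 \<zeta>
  assume wbar: "wbar \<in> horizon_vecs k N" and x0: "x0 \<in> state_space I S"
  let ?nearest = "\<lambda>w. is_arg_min (\<lambda>a. (L2_set (\<lambda>n. \<zeta> n - a n) {k..<k+N})\<^sup>2)
      (\<lambda>a. a \<in> attainable_averages k N T I S w x0)"
  have "demand_set k N T (S i) (w i) (x0 i) \<noteq> {}" if "i \<in> {1..I}" for w i
    using assms(4)[OF that] assms(8)[OF that] x0 that
    by (intro demand_set_nonempty) (auto simp: state_space_def PiE_iff)
  then have ex1: "\<exists>!a. ?nearest w a" for w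
    using attainable_averages_subset_horizon_vecs assms(8)
    by (intro ex1_nearest_point compact_attainable_averages attainable_averages_nonempty
        attainable_averages_midpoint) (auto simp: horizon_vecs_def)
  \<comment> \<open>Giving every subsystem the consumption \<open>wbar\<close> shows that some family has this average;
    otherwise every vector would qualify vacuously as \<open>zbar\<close>.\<close>
  define w0 where "w0 = (\<lambda>i\<in>{1..I}. wbar)"
  have w0: "w0 \<in> {1..I} \<rightarrow>\<^sub>E horizon_vecs k N"
    using wbar by (auto simp: w0_def)
  have avg0: "average k N I w0 = wbar"
    using wbar \<open>I \<ge> 1\<close> by (auto simp: w0_def average_def horizon_vecs_def PiE_iff extensional_def fun_eq_iff)
  have sol: "is_solution k N T I S w x0 \<zeta> zbar \<longleftrightarrow> ?nearest w0 zbar"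
    if "average k N I w = wbar" for w zbar
    using is_solution_iff[OF ex1] attainable_averages_cong[of k N I w w0] that avg0 by simp
  have "(zbar \<in> horizon_vecs k N \<and> (\<forall>w \<in> {1..I} \<rightarrow>\<^sub>E horizon_vecs k N.
         average k N I w = wbar \<longrightarrow> is_solution k N T I S w x0 \<zeta> zbar)) \<longleftrightarrow> ?nearest w0 zbar" for zbar
  proof
    assume "?nearest w0 zbar"
    then have "is_solution k N T I S w x0 \<zeta> zbar" if "average k N I w = wbar" for w
      using sol[OF that] by blast
    moreover from this[OF avg0] have "zbar \<in> horizon_vecs k N"
      by (simp add: is_solution_def)
    ultimately show "zbar \<in> horizon_vecs k N \<and> (\<forall>w \<in> {1..I} \<rightarrow>\<^sub>E horizon_vecs k N.
         average k N I w = wbar \<longrightarrow> is_solution k N T I S w x0 \<zeta> zbar)"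
      by blast
  qed (use sol w0 avg0 in blast)
  then show "\<exists>!zbar. zbar \<in> horizon_vecs k N \<and> (\<forall>w \<in> {1..I} \<rightarrow>\<^sub>E horizon_vecs k N.
         average k N I w = wbar \<longrightarrow> is_solution k N T I S w x0 \<zeta> zbar)"
    using ex1[of w0] by simp
qed

end
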